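(* For every $\epsilon > 0$ there exists $\Delta_0 = \Delta_0(\epsilon)$ such that the following holds. For every $\Delta \ge \Delta_0$ there exists $N_0 = N_0(\Delta)$ such that if $G = (U \cup V, E)$ is a bipartite graph with bipartition $(U,V)$, $|U| = |V| = n \ge N_0$, and maximum degree $\Delta$, then $$\chi_B(G) \le (1+\epsilon)\frac{\Delta}{\log \Delta}.$$
   Context: A bipartite graph $G=(U\cup V,E)$ has a prescribed vertex bipartition $(U,V)$; it is balanced if $|U|=|V|$. A bi-hole is a pair $(X,Y)$ with $X \subseteq U$, $Y \subseteq V$, $|X| = |Y|$, such that no edge of $G$ joins a vertex of $X$ to a vertex of $Y$. A coloring of all the vertices of $G$ is called balanced if each color class $C$ induces a bi-hole, i.e. $(C\cap U, C\cap V)$ is a bi-hole (in particular $|C\cap U| = |C\cap V|$). The coloring number $\chi_B(G)$ is the minimum number of colors in a balanced coloring of $G$. $\log$ denotes the natural logarithm. *)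

theory Defs
  imports "HOL-Library.Extended_Real"
begin

definition bipartite_graph :: "'a set \<Rightarrow> 'a set \<Rightarrow> 'a set set \<Rightarrow> bool" where
  "bipartite_graph U V E \<longleftrightarrow> finite U \<and> finite V \<and> U \<inter> V = {} \<and>
     (\<forall>e\<in>E. \<exists>u\<in>U. \<exists>v\<in>V. e = {u, v})"

definition degree :: "'a set set \<Rightarrow> 'a \<Rightarrow> nat" where
  "degree E v = card {e \<in> E. v \<in> e}"

definition max_degree :: "'a set \<Rightarrow> 'a set \<Rightarrow> 'a set set \<Rightarrow> nat" where
  "max_degree U V E = Max (degree E ` (U \<union> V))"

definition bi_hole :: "'a set \<Rightarrow> 'a set \<Rightarrow> 'a set set \<Rightarrow> 'a set \<Rightarrow> 'a set \<Rightarrow> bool" where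
  "bi_hole U V E X Y \<longleftrightarrow> X \<subseteq> U \<and> Y \<subseteq> V \<and> card X = card Y \<and>
     (\<forall>x\<in>X. \<forall>y\<in>Y. {x, y} \<notin> E)"

definition color_class :: "'a set \<Rightarrow> 'a set \<Rightarrow> ('a \<Rightarrow> nat) \<Rightarrow> nat \<Rightarrow> 'a set" where
  "color_class U V c i = {x \<in> U \<union> V. c x = i}"

text \<open>Unused colors give empty classes, for which the condition holds trivially.\<close>

definition balanced_coloring ::
    "'a set \<Rightarrow> 'a set \<Rightarrow> 'a set set \<Rightarrow> ('a \<Rightarrow> nat) \<Rightarrow> bool" where
  "balanced_coloring U V E c \<longleftrightarrow>
     (\<forall>i. bi_hole U V E (color_class U V c i \<inter> U) (color_class U V c i \<inter> V))"

text \<open>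
  The value is an extended natural number because a graph may have no balanced coloring
  (for example, a nonempty complete bipartite graph); the infimum is then \<open>\<infinity>\<close>. Hence a finite
  upper bound on it includes the existence of a balanced coloring. Only the colors that are
  actually used on the vertices are counted.
\<close>

definition chi_B :: "'a set \<Rightarrow> 'a set \<Rightarrow> 'a set set \<Rightarrow> enat" where
  "chi_B U V E = (INF c\<in>{c. balanced_coloring U V E c}. enat (card (c ` (U \<union> V))))"

end

theory Submission
  imports Defs "HOL-Library.FuncSet" "HOL-Real_Asymp.Real_Asymp"
begin

text \<open>
  Take \<open>k = \<lfloor>(1 + \<epsilon> / 2) \<Delta> / ln \<Delta>\<rfloor>\<close> and give every vertex of \<open>U \<union> V\<close> an independent uniform
  label in \<open>{..<k}\<close>. A vertex of \<open>U\<close> is colored by its label; a vertex of \<open>V\<close> takes the first color,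
  cyclically from its label, that is missing on its neighborhood. By the coupon collector bound a
  vertex of \<open>V\<close> has no missing color with probability at most \<open>1 / (8 \<Delta>\<^sup>2)\<close>. Rotating all labels
  shows that a vertex of \<open>V\<close> is equally likely to get each color, and dependencies are local, so
  Chebyshev's second moment argument makes the classes on both sides nearly equal for large \<open>n\<close>.
  Trimming the classes to equal sizes leaves at most \<open>n / (4 \<Delta>\<^sup>2)\<close> vertices uncolored on each side.
  These sets have so few neighbors that they can be completed to two further bi-holes by vertices
  taken from one large class.
\<close>

section \<open>Averages over a finite uniform sample space\<close>

definition avg :: "'b set \<Rightarrow> ('b \<Rightarrow> real) \<Rightarrow> real" where
  "avg \<Omega> f = (\<Sum>\<omega>\<in>\<Omega>. f \<omega>) / real (card \<Omega>)"

lemma avg_add: "avg \<Omega> (\<lambda>\<omega>. f \<omega> + g \<omega>) = avg \<Omega> f + avg \<Omega> g"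
  by (simp add: avg_def sum.distrib add_divide_distrib)

lemma avg_diff: "avg \<Omega> (\<lambda>\<omega>. f \<omega> - g \<omega>) = avg \<Omega> f - avg \<Omega> g"
  by (simp add: avg_def sum_subtractf diff_divide_distrib)

lemma avg_cmult: "avg \<Omega> (\<lambda>\<omega>. c * f \<omega>) = c * avg \<Omega> f"
  by (simp add: avg_def sum_distrib_left)

lemma avg_sum: "avg \<Omega> (\<lambda>\<omega>. \<Sum>i\<in>S. f i \<omega>) = (\<Sum>i\<in>S. avg \<Omega> (f i))"
  unfolding avg_def by (subst sum.swap) (simp add: sum_divide_distrib)

lemma avg_const: "finite \<Omega> \<Longrightarrow> \<Omega> \<noteq> {} \<Longrightarrow> avg \<Omega> (\<lambda>_. c) = c"
  by (simp add: avg_def)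

lemma avg_cong: "(\<And>\<omega>. \<omega> \<in> \<Omega> \<Longrightarrow> f \<omega> = g \<omega>) \<Longrightarrow> avg \<Omega> f = avg \<Omega> g"
  by (simp add: avg_def)

lemma avg_mono: "(\<And>\<omega>. \<omega> \<in> \<Omega> \<Longrightarrow> f \<omega> \<le> g \<omega>) \<Longrightarrow> avg \<Omega> f \<le> avg \<Omega> g"
  unfolding avg_def by (intro divide_right_mono sum_mono) auto

lemma exists_le_avg:
  assumes "finite \<Omega>" "\<Omega> \<noteq> {}"
  shows "\<exists>\<omega>\<in>\<Omega>. f \<omega> \<le> avg \<Omega> f"
proof (rule ccontr)
  assume "\<not> ?thesis"
  then have "(\<Sum>\<omega>\<in>\<Omega>. avg \<Omega> f) < (\<Sum>\<omega>\<in>\<Omega>. f \<omega>)"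
    using assms by (intro sum_strict_mono) auto
  then show False using assms by (simp add: avg_def)
qed

text \<open>Passes from a second moment to a first absolute moment. Instead of Cauchy-Schwarz it
  averages the pointwise AM-GM bound
  \<open>\<bar>f\<bar> \<le> f\<^sup>2 / (2 * t) + t / 2\<close>.\<close>

lemma avg_abs_le:
  assumes "finite \<Omega>" "\<Omega> \<noteq> {}" "t > 0" "avg \<Omega> (\<lambda>\<omega>. (f \<omega>)\<^sup>2) \<le> t\<^sup>2"
  shows "avg \<Omega> (\<lambda>\<omega>. \<bar>f \<omega>\<bar>) \<le> t"
proof -
  have "\<bar>f \<omega>\<bar> \<le> (1 / (2 * t)) * (f \<omega>)\<^sup>2 + t / 2" for \<omega>
  proof -
    have "0 \<le> (\<bar>f \<omega>\<bar> - t)\<^sup>2 / (2 * t)" using assms by simp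
    then show ?thesis using assms by (simp add: power2_diff field_simps power2_eq_square)
  qed
  then have "avg \<Omega> (\<lambda>\<omega>. \<bar>f \<omega>\<bar>) \<le> avg \<Omega> (\<lambda>\<omega>. (1 / (2 * t)) * (f \<omega>)\<^sup>2 + t / 2)"
    by (intro avg_mono)
  also have "\<dots> = (1 / (2 * t)) * avg \<Omega> (\<lambda>\<omega>. (f \<omega>)\<^sup>2) + t / 2"
    unfolding avg_add avg_cmult using assms by (simp add: avg_const)
  also have "\<dots> \<le> (1 / (2 * t)) * t\<^sup>2 + t / 2"
    using assms by (intro add_right_mono mult_left_mono) auto
  also have "\<dots> = t" using assms by (simp add: power2_eq_square)
  finally show ?thesis .
qed

section \<open>Independence and the second moment bound\<close>

text \<open>The finite counterpart of measurability with respect to the coordinates in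
  \<open>A\<close>. On a product space, disjoint coordinate sets then yield independence.\<close>

definition depends_on :: "('i \<Rightarrow> 'c) set \<Rightarrow> (('i \<Rightarrow> 'c) \<Rightarrow> 'b) \<Rightarrow> 'i set \<Rightarrow> bool" where
  "depends_on \<Omega> f A \<longleftrightarrow> (\<forall>\<omega>\<in>\<Omega>. \<forall>\<omega>'\<in>\<Omega>. (\<forall>x\<in>A. \<omega> x = \<omega>' x) \<longrightarrow> f \<omega> = f \<omega>')"

lemma depends_onD:
  "depends_on \<Omega> f A \<Longrightarrow> \<omega> \<in> \<Omega> \<Longrightarrow> \<omega>' \<in> \<Omega> \<Longrightarrow> (\<And>x. x \<in> A \<Longrightarrow> \<omega> x = \<omega>' x) \<Longrightarrow> f \<omega> = f \<omega>'"
  unfolding depends_on_def by blast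

lemma avg_mult_indep:
  fixes f g :: "('i \<Rightarrow> 'c) \<Rightarrow> real"
  assumes \<Omega>: "\<Omega> = I \<rightarrow>\<^sub>E K" and fin: "finite \<Omega>"
    and f: "depends_on \<Omega> f A" and g: "depends_on \<Omega> g B" and "A \<inter> B = {}"
  shows "avg \<Omega> (\<lambda>\<omega>. f \<omega> * g \<omega>) = avg \<Omega> f * avg \<Omega> g"
proof (cases "\<Omega> = {}")
  case False
  define mrg where "mrg = (\<lambda>(\<omega> :: 'i \<Rightarrow> 'c) \<omega>' x. if x \<in> A then \<omega> x else \<omega>' x)"
  have mrg: "mrg \<omega> \<omega>' \<in> \<Omega>" if "\<omega> \<in> \<Omega>" "\<omega>' \<in> \<Omega>" for \<omega> \<omega>'
    using that unfolding \<Omega> mrg_def by (auto simp: PiE_iff extensional_def)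
  \<comment> \<open>Exchanging the coordinates outside \<open>A\<close> between two independent samples is measure preserving.\<close>
  have "(\<Sum>(\<omega>, \<omega>')\<in>\<Omega> \<times> \<Omega>. f \<omega> * g \<omega>') = (\<Sum>(\<omega>, \<omega>')\<in>\<Omega> \<times> \<Omega>. f \<omega> * g \<omega>)"
  proof (rule sum.reindex_bij_witness[where i = "\<lambda>(\<omega>, \<omega>'). (mrg \<omega> \<omega>', mrg \<omega>' \<omega>)"
        and j = "\<lambda>(\<omega>, \<omega>'). (mrg \<omega> \<omega>', mrg \<omega>' \<omega>)"], goal_cases)
    case (1 a) then show ?case by (auto simp: mrg_def fun_eq_iff)
  next
    case (2 a) then show ?case using mrg by auto
  next
    case (3 a) then show ?case by (auto simp: mrg_def fun_eq_iff)
  next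
    case (4 a) then show ?case using mrg by auto
  next
    case (5 a)
    obtain \<omega> \<omega>' where a: "a = (\<omega>, \<omega>')" "\<omega> \<in> \<Omega>" "\<omega>' \<in> \<Omega>" using 5 by auto
    have "f (mrg \<omega> \<omega>') = f \<omega>"
      using a mrg by (intro depends_onD[OF f]) (auto simp: mrg_def)
    moreover have "g (mrg \<omega> \<omega>') = g \<omega>'"
      using a mrg \<open>A \<inter> B = {}\<close> by (intro depends_onD[OF g]) (auto simp: mrg_def)
    ultimately show ?case using a by simp
  qed
  then have "sum f \<Omega> * sum g \<Omega> = card \<Omega> * (\<Sum>\<omega>\<in>\<Omega>. f \<omega> * g \<omega>)"
    by (simp only: sum_product sum.cartesian_product[symmetric]) (simp add: sum_distrib_left)
  then show ?thesis using False fin by (simp add: avg_def field_simps)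
qed (simp add: avg_def)

text \<open>The variance of the sum is the sum of all covariances. A pair with disjoint coordinate
  sets contributes 0 by independence; any other pair contributes at most 1, because the product is
  at most 1 and the means are nonnegative. Each \<open>v\<close> is in at most \<open>D\<close>
  pairs of the second kind.\<close>

lemma avg_square_deviation_le:
  fixes X :: "'v \<Rightarrow> ('i \<Rightarrow> 'c) \<Rightarrow> real"
  assumes \<Omega>: "\<Omega> = I \<rightarrow>\<^sub>E K" and fin: "finite \<Omega>" and ne: "\<Omega> \<noteq> {}" and S: "finite S"
    and X01: "\<And>v \<omega>. v \<in> S \<Longrightarrow> \<omega> \<in> \<Omega> \<Longrightarrow> 0 \<le> X v \<omega> \<and> X v \<omega> \<le> 1"
    and dep: "\<And>v. v \<in> S \<Longrightarrow> depends_on \<Omega> (X v) (A v)"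
    and D: "\<And>v. v \<in> S \<Longrightarrow> card {w \<in> S. A v \<inter> A w \<noteq> {}} \<le> D"
  shows "avg \<Omega> (\<lambda>\<omega>. ((\<Sum>v\<in>S. X v \<omega>) - (\<Sum>v\<in>S. avg \<Omega> (X v)))\<^sup>2) \<le> real (card S) * real D"
proof -
  define m where "m v = avg \<Omega> (X v)" for v
  have m0: "0 \<le> m v" if "v \<in> S" for v
    unfolding m_def avg_def using that X01 by (intro divide_nonneg_nonneg sum_nonneg) auto
  have cov: "avg \<Omega> (\<lambda>\<omega>. (X v \<omega> - m v) * (X w \<omega> - m w)) = avg \<Omega> (\<lambda>\<omega>. X v \<omega> * X w \<omega>) - m v * m w" for v w
  proof -
    have "avg \<Omega> (\<lambda>\<omega>. (X v \<omega> - m v) * (X w \<omega> - m w))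
        = avg \<Omega> (\<lambda>\<omega>. (X v \<omega> * X w \<omega> + m v * m w) - (m v * X w \<omega> + m w * X v \<omega>))"
      by (intro avg_cong) (simp add: algebra_simps)
    also have "\<dots> = avg \<Omega> (\<lambda>\<omega>. X v \<omega> * X w \<omega>) - m v * m w"
      using fin ne by (simp add: avg_diff avg_add avg_cmult avg_const m_def[symmetric])
    finally show ?thesis .
  qed
  have cov_le: "avg \<Omega> (\<lambda>\<omega>. (X v \<omega> - m v) * (X w \<omega> - m w)) \<le> (if A v \<inter> A w \<noteq> {} then 1 else 0)"
    if vw: "v \<in> S" "w \<in> S" for v w
  proof (cases "A v \<inter> A w = {}")
    case True
    then show ?thesis
      using avg_mult_indep[OF \<Omega> fin dep[OF vw(1)] dep[OF vw(2)]] by (simp add: cov, simp add: m_def)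
  next
    case False
    have "avg \<Omega> (\<lambda>\<omega>. X v \<omega> * X w \<omega>) \<le> avg \<Omega> (\<lambda>_. 1)"
      using X01 vw by (intro avg_mono mult_le_one) auto
    moreover have "0 \<le> m v * m w" using m0 vw by simp
    ultimately show ?thesis using False fin ne by (simp add: cov avg_const)
  qed
  have "avg \<Omega> (\<lambda>\<omega>. ((\<Sum>v\<in>S. X v \<omega>) - (\<Sum>v\<in>S. m v))\<^sup>2)
      = (\<Sum>v\<in>S. \<Sum>w\<in>S. avg \<Omega> (\<lambda>\<omega>. (X v \<omega> - m v) * (X w \<omega> - m w)))"
    by (simp add: avg_sum[symmetric] sum_subtractf[symmetric] power2_eq_square sum_product)
  also have "\<dots> \<le> (\<Sum>v\<in>S. \<Sum>w\<in>S. if A v \<inter> A w \<noteq> {} then 1 else 0)"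
    by (intro sum_mono cov_le)
  also have "\<dots> = (\<Sum>v\<in>S. real (card {w \<in> S. A v \<inter> A w \<noteq> {}}))"
    using S by (intro sum.cong refl) (simp add: sum.If_cases Int_def)
  also have "\<dots> \<le> (\<Sum>v\<in>S. real D)" using D by (intro sum_mono) simp
  finally show ?thesis by (simp add: m_def)
qed

section \<open>Rotation symmetry and the choice of a missing color\<close>

text \<open>The restriction to \<open>I\<close> keeps the rotated labeling extensional, so that it
  remains in \<open>I \<rightarrow>\<^sub>E {..<k}\<close>.\<close>

definition rotate_colors :: "nat \<Rightarrow> 'i set \<Rightarrow> nat \<Rightarrow> ('i \<Rightarrow> nat) \<Rightarrow> 'i \<Rightarrow> nat" where
  "rotate_colors k I t \<omega> = (\<lambda>x\<in>I. (\<omega> x + t) mod k)"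

text \<open>Rotation by \<open>t\<close> permutes the sample space; its inverse is rotation by
  \<open>k - t\<close>, where \<open>t \<le> k\<close> makes the subtraction exact.\<close>

lemma avg_rotate_colors:
  assumes \<Omega>: "\<Omega> = I \<rightarrow>\<^sub>E {..<k}" and t: "t \<le> k"
  shows "avg \<Omega> (\<lambda>\<omega>. f (rotate_colors k I t \<omega>)) = avg \<Omega> f"
proof -
  have inv: "rotate_colors k I s (rotate_colors k I r \<omega>) = \<omega>"
    if "\<omega> \<in> \<Omega>" "r + s = k" for r s \<omega>
  proof
    fix x
    have "((\<omega> x + r) mod k + s) mod k = \<omega> x" if "x \<in> I"
    proof -
      have "\<omega> x < k" using that \<open>\<omega> \<in> \<Omega>\<close> \<Omega> by auto
      moreover have "((\<omega> x + r) mod k + s) mod k = (\<omega> x + k) mod k"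
        using \<open>r + s = k\<close> by (simp add: mod_add_left_eq add.assoc)
      ultimately show ?thesis by simp
    qed
    then show "rotate_colors k I s (rotate_colors k I r \<omega>) x = \<omega> x"
      using that \<Omega> by (auto simp: rotate_colors_def PiE_def extensional_def)
  qed
  have mem: "rotate_colors k I r \<omega> \<in> \<Omega>" if "\<omega> \<in> \<Omega>" for r \<omega>
  proof -
    have "k > 0" if "x \<in> I" for x using that \<open>\<omega> \<in> \<Omega>\<close> \<Omega> by fastforce
    then show ?thesis by (auto simp: rotate_colors_def \<Omega>)
  qed
  have "(\<Sum>\<omega>\<in>\<Omega>. f (rotate_colors k I t \<omega>)) = sum f \<Omega>"
    by (rule sum.reindex_bij_witness[where i = "rotate_colors k I (k - t)" and j = "rotate_colors k I t"])
      (use inv mem t in auto)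
  then show ?thesis by (simp add: avg_def)
qed

lemma add_mod_eq_iff:
  fixes a b k t :: nat
  assumes "a < k" "b < k"
  shows "(a + t) mod k = (b + t) mod k \<longleftrightarrow> a = b"
proof -
  define r where "r = t mod k"
  have "r < k" using assms unfolding r_def by (intro mod_less_divisor) linarith
  have "(x + t) mod k = (if x + r < k then x + r else x + r - k)" if "x < k" for x
  proof -
    have "(x + t) mod k = (x + r) mod k" unfolding r_def by (rule mod_add_right_eq[symmetric])
    also have "\<dots> = (if x + r < k then x + r else x + r - k)"
      using that \<open>r < k\<close> by (simp add: le_mod_geq)
    finally show ?thesis .
  qed
  from this[OF \<open>a < k\<close>] this[OF \<open>b < k\<close>] show ?thesis
    using assms \<open>r < k\<close> by (simp split: if_splits) linarith
qed

text \<open>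
  The first color in the cyclic order starting at \<open>s\<close> that does not occur in \<open>M\<close>; the value \<open>k\<close>
  signals that every color occurs.
\<close>

definition pick_color :: "nat \<Rightarrow> nat \<Rightarrow> nat set \<Rightarrow> nat" where
  "pick_color k s M =
     (if {..<k} \<subseteq> M then k else (s + (LEAST j. (s + j) mod k \<notin> M)) mod k)"

lemma pick_color_avoids:
  assumes "s < k" "\<not> {..<k} \<subseteq> M"
  shows "pick_color k s M < k" "pick_color k s M \<notin> M"
proof -
  define j where "j = (LEAST j. (s + j) mod k \<notin> M)"
  obtain m where m: "m < k" "m \<notin> M" using assms(2) by (meson subsetI lessThan_iff)
  \<comment> \<open>From \<open>s\<close>, a walk of \<open>k - s + m\<close> steps ends at
    \<open>k + m\<close>, which is congruent to the missing color \<open>m\<close>. So the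
    \<open>LEAST\<close> ranges over a nonempty set.\<close>
  have a: "s + (k - s + m) = k + m" using \<open>s < k\<close> by linarith
  have "(k + m) mod k \<notin> M" using m by simp
  then have "(s + (k - s + m)) mod k \<notin> M" unfolding a .
  then have b: "(s + j) mod k \<notin> M" unfolding j_def by (rule LeastI)
  have c: "pick_color k s M = (s + j) mod k"
    unfolding pick_color_def j_def by (rule if_not_P) fact
  show "pick_color k s M < k"
    unfolding c using \<open>s < k\<close> by (intro mod_less_divisor) linarith
  show "pick_color k s M \<notin> M" unfolding c using b .
qed

text \<open>Rotating the start and the forbidden set together changes none of the membership tests,
  so the search stops after the same number of steps and its result is rotated. The inclusion of
  \<open>M\<close> in \<open>{..<k}\<close> matters because the rotation is injective on that
  range.\<close>

lemma pick_color_rotate: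
  assumes M: "M \<subseteq> {..<k}" and "s < k"
  shows "pick_color k ((s + t) mod k) ((\<lambda>x. (x + t) mod k) ` M)
    = (if {..<k} \<subseteq> M then k else (pick_color k s M + t) mod k)"
proof -
  let ?r = "\<lambda>x. (x + t) mod k"
  have inj: "inj_on ?r {..<k}" by (auto simp: inj_on_def add_mod_eq_iff)
  have "?r ` {..<k} \<subseteq> {..<k}" using assms by auto
  then have surj: "?r ` {..<k} = {..<k}"
    using inj by (simp add: endo_inj_surj)
  have all: "{..<k} \<subseteq> ?r ` M \<longleftrightarrow> {..<k} \<subseteq> M"
    by (metis M inj inj_on_image_eq_iff subset_antisym order_refl surj image_mono)
  have shift: "(?r s + j) mod k = ?r ((s + j) mod k)" for j
    by (metis add.assoc add.commute mod_add_left_eq)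
  have mem: "(?r s + j) mod k \<in> ?r ` M \<longleftrightarrow> (s + j) mod k \<in> M" for j
    unfolding shift using \<open>s < k\<close> by (intro inj_on_image_mem_iff[OF inj _ M]) auto
  show ?thesis
    unfolding pick_color_def all mem[symmetric] using shift by simp
qed

text \<open>By rotation all \<open>k\<close> values of the coordinate \<open>a\<close> have the same
  probability, and these probabilities add up to 1.\<close>

lemma avg_color_eq:
  assumes \<Omega>: "\<Omega> = I \<rightarrow>\<^sub>E {..<k}" and "finite I" "a \<in> I" "x < k"
  shows "avg \<Omega> (\<lambda>\<omega>. of_bool (\<omega> a = x)) = 1 / real k"
proof -
  have fin: "finite \<Omega>" using assms by (simp add: finite_PiE)
  have ne: "\<Omega> \<noteq> {}" using assms by (auto simp: PiE_eq_empty_iff)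
  have eq: "avg \<Omega> (\<lambda>\<omega>. of_bool (\<omega> a = y)) = avg \<Omega> (\<lambda>\<omega>. of_bool (\<omega> a = 0))" if "y < k" for y
  proof -
    have "avg \<Omega> (\<lambda>\<omega>. of_bool (\<omega> a = y)) = avg \<Omega> (\<lambda>\<omega>. of_bool (rotate_colors k I y \<omega> a = y))"
      using avg_rotate_colors[OF \<Omega>, of y "\<lambda>\<omega>. of_bool (\<omega> a = y)"] that by simp
    also have "\<dots> = avg \<Omega> (\<lambda>\<omega>. of_bool (\<omega> a = 0))"
    proof (rule avg_cong)
      fix \<omega> assume "\<omega> \<in> \<Omega>"
      then have "\<omega> a < k" using \<Omega> \<open>a \<in> I\<close> by auto
      then have "(\<omega> a + y) mod k = y \<longleftrightarrow> \<omega> a = 0"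
        using add_mod_eq_iff[of "\<omega> a" k 0 y] that by (simp only: add_0 mod_less)
      then show "of_bool (rotate_colors k I y \<omega> a = y) = (of_bool (\<omega> a = 0) :: real)"
        unfolding rotate_colors_def using \<open>a \<in> I\<close> by (simp only: restrict_apply if_True)
    qed
    finally show ?thesis .
  qed
  have "(\<Sum>y<k. avg \<Omega> (\<lambda>\<omega>. of_bool (\<omega> a = y))) = avg \<Omega> (\<lambda>\<omega>. \<Sum>y<k. of_bool (\<omega> a = y))"
    by (rule avg_sum[symmetric])
  also have "\<dots> = avg \<Omega> (\<lambda>_. 1)"
  proof (rule avg_cong)
    fix \<omega> assume "\<omega> \<in> \<Omega>"
    then have "\<omega> a < k" using \<Omega> \<open>a \<in> I\<close> by auto
    then show "(\<Sum>y<k. of_bool (\<omega> a = y)) = (1 :: real)" by (simp add: of_bool_def)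
  qed
  finally have "(\<Sum>y<k. avg \<Omega> (\<lambda>\<omega>. of_bool (\<omega> a = y))) = 1"
    using fin ne by (simp add: avg_const)
  moreover have "(\<Sum>y<k. avg \<Omega> (\<lambda>\<omega>. of_bool (\<omega> a = y)))
      = (\<Sum>y<k. avg \<Omega> (\<lambda>\<omega>. of_bool (\<omega> a = 0)))"
    by (rule sum.cong[OF refl]) (rule eq, simp)
  ultimately have "real k * avg \<Omega> (\<lambda>\<omega>. of_bool (\<omega> a = 0)) = 1" by simp
  then show ?thesis using eq[OF \<open>x < k\<close>] assms by (simp add: field_simps)
qed

section \<open>Probability that every color occurs on a neighborhood\<close>

text \<open>The left side consists of the first two terms of the binomial expansion, and the
  remaining terms are nonnegative. At \<open>j = 0\<close> the truncated exponent
  \<open>j - 1\<close> is multiplied by 0.\<close>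

lemma power_add_ge_linear:
  fixes y h :: real
  assumes "0 \<le> y" "0 \<le> h"
  shows "y ^ j + real j * y ^ (j - 1) * h \<le> (y + h) ^ j"
proof (induction j)
  case (Suc j)
  have "y * (real j * y ^ (j - 1) * h) = real j * y ^ j * h" by (cases j) auto
  moreover have "0 \<le> h * (real j * y ^ (j - 1) * h)" using assms by simp
  moreover have "(y + h) * (y ^ j + real j * y ^ (j - 1) * h)
      = y * y ^ j + h * y ^ j + y * (real j * y ^ (j - 1) * h) + h * (real j * y ^ (j - 1) * h)"
    by (simp only: distrib_left distrib_right add_ac)
  moreover have "y ^ Suc j + real (Suc j) * y ^ (Suc j - 1) * h
      = y * y ^ j + h * y ^ j + real j * y ^ j * h"
    by (simp add: distrib_right distrib_left)
  ultimately have "y ^ Suc j + real (Suc j) * y ^ (Suc j - 1) * h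
      \<le> (y + h) * (y ^ j + real j * y ^ (j - 1) * h)"
    by linarith
  also have "\<dots> \<le> (y + h) * (y + h) ^ j" using Suc assms by (intro mult_left_mono) auto
  finally show ?case by simp
qed simp

text \<open>
  The events that the individual colors occur are negatively correlated. In the induction step the color of the new point is split off, and the two cases
  combine to the first two terms of a binomial expansion.
\<close>

lemma avg_all_colors_occur_le:
  assumes \<Omega>: "\<Omega> = I \<rightarrow>\<^sub>E {..<k}" and I: "finite I" and k: "k > 0"
    and D: "D \<subseteq> I" and S: "S \<subseteq> {..<k}"
  shows "avg \<Omega> (\<lambda>\<omega>. of_bool (S \<subseteq> \<omega> ` D)) \<le> (1 - (1 - 1 / real k) ^ card D) ^ card S"
proof -
  have fin: "finite \<Omega>" using assms by (simp add: finite_PiE)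
  have ne: "\<Omega> \<noteq> {}" using assms by (auto simp: PiE_eq_empty_iff)
  have "finite D" using D I finite_subset by blast
  then show ?thesis using D S
  proof (induction D arbitrary: S)
    case empty
    show ?case
    proof (cases "S = {}")
      case False
      then have "avg \<Omega> (\<lambda>\<omega>. of_bool (S \<subseteq> \<omega> ` {})) = 0" by (simp add: avg_def)
      then show ?thesis by simp
    qed (use fin ne in \<open>simp add: avg_const\<close>)
  next
    case (insert a D)
    define y where "y = 1 - (1 - 1 / real k) ^ card D"
    define q where "q = 1 / real k"
    have y: "0 \<le> y" "y \<le> 1" and q: "0 \<le> q" "real k * q = 1"
      using k by (auto simp: y_def q_def power_le_one)
    have finS: "finite S" using insert.prems finite_subset by blast
    \<comment> \<open>If the new point \<open>a\<close> has color \<open>x\<close>, it covers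
      \<open>x\<close> itself, and \<open>D\<close> has to supply only
      \<open>S - {x}\<close>.\<close>
    have split: "of_bool (S \<subseteq> \<omega> ` insert a D)
        = (\<Sum>x<k. of_bool (\<omega> a = x) * of_bool (S - {x} \<subseteq> \<omega> ` D) :: real)" if "\<omega> \<in> \<Omega>" for \<omega>
    proof -
      have "\<omega> a < k" using that \<Omega> insert.prems by auto
      then have "(\<Sum>x<k. of_bool (\<omega> a = x) * of_bool (S - {x} \<subseteq> \<omega> ` D) :: real)
          = of_bool (S - {\<omega> a} \<subseteq> \<omega> ` D)"
        by (simp add: of_bool_def if_distrib[of "\<lambda>c. c * _"] cong: if_cong)
      then show ?thesis by (auto simp: of_bool_def)
    qed
    have indep: "avg \<Omega> (\<lambda>\<omega>. of_bool (\<omega> a = x) * of_bool (S - {x} \<subseteq> \<omega> ` D))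
        = q * avg \<Omega> (\<lambda>\<omega>. of_bool (S - {x} \<subseteq> \<omega> ` D))" if "x < k" for x
    proof -
      have "depends_on \<Omega> (\<lambda>\<omega>. of_bool (\<omega> a = x) :: real) {a}"
        by (simp add: depends_on_def)
      moreover have "depends_on \<Omega> (\<lambda>\<omega>. of_bool (S - {x} \<subseteq> \<omega> ` D) :: real) D"
        unfolding depends_on_def by (auto cong: image_cong)
      ultimately show ?thesis
        unfolding q_def using avg_mult_indep[OF \<Omega> fin] avg_color_eq[OF \<Omega> I _ that, of a] insert.hyps insert.prems
        by auto
    qed
    \<comment> \<open>Here \<open>y\<close> is the probability that a fixed color occurs on
      \<open>D\<close>. It occurs on \<open>insert a D\<close> if it occurs on \<open>D\<close>
      already or, failing that, if \<open>a\<close> receives it.\<close>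
    have y_step: "y + (1 - y) * q = 1 - (1 - 1 / real k) ^ card (insert a D)"
    proof -
      have "1 - (y + (1 - y) * q) = (1 - q) * (1 - y)" by (simp add: algebra_simps)
      also have "\<dots> = (1 - 1 / real k) ^ card (insert a D)"
        using insert.hyps by (simp add: y_def q_def)
      finally show ?thesis by linarith
    qed
    have "0 \<le> (1 - y) * q" using y q by simp
    note binom = power_add_ge_linear[OF y(1) this, of "card S", unfolded y_step]
    have "avg \<Omega> (\<lambda>\<omega>. of_bool (S \<subseteq> \<omega> ` insert a D))
        = (\<Sum>x<k. q * avg \<Omega> (\<lambda>\<omega>. of_bool (S - {x} \<subseteq> \<omega> ` D)))"
    proof -
      have "avg \<Omega> (\<lambda>\<omega>. of_bool (S \<subseteq> \<omega> ` insert a D))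
          = avg \<Omega> (\<lambda>\<omega>. \<Sum>x<k. of_bool (\<omega> a = x) * of_bool (S - {x} \<subseteq> \<omega> ` D))"
        by (rule avg_cong) (rule split)
      also have "\<dots> = (\<Sum>x<k. q * avg \<Omega> (\<lambda>\<omega>. of_bool (S - {x} \<subseteq> \<omega> ` D)))"
        unfolding avg_sum using indep by (intro sum.cong) auto
      finally show ?thesis .
    qed
    also have "\<dots> \<le> (\<Sum>x<k. q * y ^ card (S - {x}))"
      using insert.prems q unfolding y_def by (intro sum_mono mult_left_mono insert.IH) auto
    \<comment> \<open>A color in \<open>S\<close> leaves \<open>card S - 1\<close> colors for
      \<open>D\<close>; a color outside \<open>S\<close> leaves all of them.\<close>
    also have "\<dots> = (\<Sum>x\<in>S. q * y ^ card (S - {x})) + (\<Sum>x\<in>{..<k} - S. q * y ^ card (S - {x}))"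
      using insert.prems by (subst sum.subset_diff[of S]) auto
    also have "\<dots> = (\<Sum>x\<in>S. q * y ^ (card S - 1)) + (\<Sum>x\<in>{..<k} - S. q * y ^ card S)"
      using finS by (intro arg_cong2[where f = "(+)"] sum.cong) auto
    also have "\<dots> = q * (real (card S) * y ^ (card S - 1)) + q * ((real k - real (card S)) * y ^ card S)"
      using insert.prems finS card_mono[OF _ insert.prems(2)]
      by (simp add: card_Diff_subset of_nat_diff)
    \<comment> \<open>Collected in this way, the sum is the linear lower bound \<open>binom\<close>
      with increment \<open>(1 - y) * q\<close>.\<close>
    also have "\<dots> = y ^ card S + real (card S) * y ^ (card S - 1) * ((1 - y) * q)"
    proof -
      have "q * (real (card S) * y ^ card S) = real (card S) * y ^ (card S - 1) * (y * q)"
        by (cases "card S") auto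
      moreover have "q * (real k * y ^ card S) = y ^ card S"
        using q by (metis mult.assoc mult.commute mult_1)
      ultimately show ?thesis
        by (simp only: left_diff_distrib right_diff_distrib mult_1_left mult_1_right mult_ac)
    qed
    also note binom
    finally show ?case .
  qed
qed

section \<open>The random partial coloring\<close>

text \<open>Bounds the expected total mismatch of the random coloring and takes a sample that does
  not exceed it. The first summand of the bound pays for the fluctuation of the class sizes on both
  sides, the second for the uncolored vertices of \<open>V\<close>, which the construction marks by
  \<open>g v = k\<close>.\<close>

lemma exists_nearly_balanced_partial_coloring:
  fixes U V :: "'a set" and N :: "'a \<Rightarrow> 'a set" and k \<Delta> n :: nat
  assumes U: "finite U" "card U = n" and V: "finite V" "card V = n" and UV: "U \<inter> V = {}"
    and n: "n > 0" and k: "k > 0"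
    and N: "\<And>v. v \<in> V \<Longrightarrow> N v \<subseteq> U" "\<And>v. v \<in> V \<Longrightarrow> card (N v) \<le> \<Delta>"
    and deg: "\<And>u. u \<in> U \<Longrightarrow> card {v \<in> V. u \<in> N v} \<le> \<Delta>"
  shows "\<exists>f g. (\<forall>u\<in>U. f u < k) \<and> (\<forall>v\<in>V. g v < k \<longrightarrow> g v \<notin> f ` N v) \<and>
    (\<Sum>i<k. \<bar>real (card {u \<in> U. f u = i}) - real (card {v \<in> V. g v = i})\<bar>)
      \<le> 2 * real k * sqrt (real n * (real \<Delta> ^ 2 + 1)) + real n * (1 - (1 - 1 / real k) ^ \<Delta>) ^ k"
proof -
  define I where "I = U \<union> V"
  define \<Omega> where \<Omega>: "\<Omega> = I \<rightarrow>\<^sub>E {..<k}"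
  \<comment> \<open>The color of \<open>v\<close> is determined by its own label and the labels of
    its neighbors.\<close>
  define A where "A v = insert v (N v)" for v
  define g where "g \<omega> v = pick_color k (\<omega> v) (\<omega> ` N v)" for \<omega> and v :: 'a
  define p where "p = (1 - (1 - 1 / real k) ^ \<Delta>) ^ k"
  \<comment> \<open>\<open>t\<^sup>2\<close> bounds the variance of the size of a class: there are
    \<open>n\<close> vertices, and each shares a coordinate with at most
    \<open>\<Delta>\<^sup>2 + 1\<close> vertices, itself included.\<close>
  define t where "t = sqrt (real n * (real \<Delta> ^ 2 + 1))"
  define X where "X i v \<omega> = (of_bool (g \<omega> v = i) :: real)" for i v \<omega>
  \<comment> \<open>The probability that \<open>v\<close> stays uncolored.\<close>
  define b where "b v = avg \<Omega> (X k v)" for v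
  have I: "finite I" using U V by (simp add: I_def)
  have fin: "finite \<Omega>" using I by (simp add: \<Omega> finite_PiE)
  have ne: "\<Omega> \<noteq> {}" using k by (auto simp: \<Omega> PiE_eq_empty_iff)
  have rng: "\<omega> x < k" if "\<omega> \<in> \<Omega>" "x \<in> I" for \<omega> x using that by (auto simp: \<Omega>)
  have t: "t > 0" "t\<^sup>2 = real n * real (\<Delta>\<^sup>2 + 1)"
    using n by (auto simp: t_def intro!: mult_pos_pos add_nonneg_pos)
  have NI: "N v \<subseteq> I" "v \<in> I" if "v \<in> V" for v using N that by (auto simp: I_def)

  have g_eq_k: "g \<omega> v = k \<longleftrightarrow> {..<k} \<subseteq> \<omega> ` N v" if "\<omega> \<in> \<Omega>" "v \<in> V" for \<omega> v
  proof (cases "{..<k} \<subseteq> \<omega> ` N v")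
    case True
    then show ?thesis unfolding g_def pick_color_def by (simp only: if_True simp_thms)
  next
    case False
    have "g \<omega> v < k"
      unfolding g_def by (rule pick_color_avoids(1)[OF rng[OF that(1) NI(2)[OF that(2)]] False])
    then show ?thesis using False by blast
  qed
  have b_le: "b v \<le> p" if v: "v \<in> V" for v
  proof -
    have "b v = avg \<Omega> (\<lambda>\<omega>. of_bool ({..<k} \<subseteq> \<omega> ` N v))"
      unfolding b_def by (rule avg_cong) (simp only: X_def g_eq_k v)
    also have "\<dots> \<le> (1 - (1 - 1 / real k) ^ card (N v)) ^ k"
      using avg_all_colors_occur_le[OF \<Omega> I k NI(1)[OF v], of "{..<k}"] by simp
    also have "\<dots> \<le> p"
      unfolding p_def using k N(2)[OF v]
      by (intro power_mono diff_left_mono power_decreasing) (auto simp: power_le_one)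
    finally show ?thesis .
  qed
  \<comment> \<open>By rotation the \<open>k\<close> proper colors are equally likely for
    \<open>v\<close>, so they share the remaining probability \<open>1 - b v\<close>
    equally.\<close>
  have avg_X: "avg \<Omega> (X i v) = (1 - b v) / real k" if v: "v \<in> V" and "i < k" for v i
  proof -
    have zero: "avg \<Omega> (X j v) = avg \<Omega> (X 0 v)" if "j < k" for j
    proof -
      have "avg \<Omega> (X j v) = avg \<Omega> (\<lambda>\<omega>. X j v (rotate_colors k I j \<omega>))"
        using avg_rotate_colors[OF \<Omega>, of j "X j v"] that by simp
      also have "\<dots> = avg \<Omega> (X 0 v)"
      proof (rule avg_cong)
        fix \<omega> assume \<omega>: "\<omega> \<in> \<Omega>"
        have vI: "v \<in> I" and NI': "N v \<subseteq> I" using NI v by auto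
        have s: "\<omega> v < k" using rng \<omega> vI by auto
        have M: "\<omega> ` N v \<subseteq> {..<k}" using rng \<omega> NI' by auto
        have "rotate_colors k I j \<omega> ` N v = (\<lambda>x. (x + j) mod k) ` \<omega> ` N v"
          unfolding image_image rotate_colors_def using NI' by (intro image_cong) auto
        moreover have "rotate_colors k I j \<omega> v = (\<omega> v + j) mod k"
          using vI by (simp only: rotate_colors_def restrict_apply if_True)
        ultimately have "g (rotate_colors k I j \<omega>) v
            = (if {..<k} \<subseteq> \<omega> ` N v then k else (g \<omega> v + j) mod k)"
          unfolding g_def using pick_color_rotate[OF M s, of j] by simp
        moreover have "(g \<omega> v + j) mod k = j \<longleftrightarrow> g \<omega> v = 0" if "\<not> {..<k} \<subseteq> \<omega> ` N v"
        proof -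
          have "g \<omega> v < k" unfolding g_def by (rule pick_color_avoids(1)[OF s that])
          then show ?thesis
            using add_mod_eq_iff[of "g \<omega> v" k 0 j] \<open>j < k\<close> by (simp only: add_0 mod_less)
        qed
        moreover have "g \<omega> v = k" if "{..<k} \<subseteq> \<omega> ` N v" using g_eq_k \<omega> v that by simp
        ultimately have "g (rotate_colors k I j \<omega>) v = j \<longleftrightarrow> g \<omega> v = 0"
          using \<open>j < k\<close> by (cases "{..<k} \<subseteq> \<omega> ` N v") auto
        then show "X j v (rotate_colors k I j \<omega>) = X 0 v \<omega>" by (simp add: X_def)
      qed
      finally show ?thesis .
    qed
    \<comment> \<open>The range \<open>Suc k\<close> includes the value \<open>k\<close> of an
      uncolored vertex, so exactly one summand is 1 for each sample.\<close>
    have "(\<Sum>j<Suc k. avg \<Omega> (X j v)) = avg \<Omega> (\<lambda>\<omega>. \<Sum>j<Suc k. X j v \<omega>)"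
      by (rule avg_sum[symmetric])
    also have "\<dots> = avg \<Omega> (\<lambda>_. 1)"
    proof (rule avg_cong)
      fix \<omega> assume \<omega>: "\<omega> \<in> \<Omega>"
      have "g \<omega> v < k" if "g \<omega> v \<noteq> k"
        using pick_color_avoids(1)[OF rng[OF \<omega> NI(2)[OF v]], of "\<omega> ` N v"] g_eq_k[OF \<omega> v] that
        unfolding g_def by blast
      then have "g \<omega> v < Suc k" by (metis less_Suc_eq)
      then show "(\<Sum>j<Suc k. X j v \<omega>) = 1" by (simp add: X_def of_bool_def del: sum.lessThan_Suc)
    qed
    finally have "(\<Sum>j<k. avg \<Omega> (X j v)) + b v = 1"
      using fin ne by (simp add: avg_const b_def)
    moreover have "(\<Sum>j<k. avg \<Omega> (X j v)) = (\<Sum>j<k. avg \<Omega> (X 0 v))"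
      by (rule sum.cong[OF refl]) (rule zero, simp)
    ultimately have "real k * avg \<Omega> (X 0 v) + b v = 1" by simp
    then show ?thesis using zero[OF \<open>i < k\<close>] k by (simp add: field_simps)
  qed

  have dev_U: "avg \<Omega> (\<lambda>\<omega>. \<bar>(\<Sum>u\<in>U. of_bool (\<omega> u = i)) - real n / real k\<bar>) \<le> t" if i: "i < k" for i
  proof (rule avg_abs_le[OF fin ne t(1)])
    have mean: "(\<Sum>u\<in>U. avg \<Omega> (\<lambda>\<omega>. of_bool (\<omega> u = i))) = real n / real k"
      using avg_color_eq[OF \<Omega> I _ i] U by (simp add: I_def)
    have "avg \<Omega> (\<lambda>\<omega>. ((\<Sum>u\<in>U. of_bool (\<omega> u = i)) - (\<Sum>u\<in>U. avg \<Omega> (\<lambda>\<omega>. of_bool (\<omega> u = i))))\<^sup>2)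
        \<le> real (card U) * real (\<Delta>\<^sup>2 + 1)"
    proof (rule avg_square_deviation_le[OF \<Omega> fin ne U(1)])
      fix u assume "u \<in> U"
      show "depends_on \<Omega> (\<lambda>\<omega>. of_bool (\<omega> u = i) :: real) {u}" by (simp add: depends_on_def)
      have "{w \<in> U. {u} \<inter> {w} \<noteq> {}} = {u}" using \<open>u \<in> U\<close> by auto
      then show "card {w \<in> U. {u} \<inter> {w} \<noteq> {}} \<le> \<Delta>\<^sup>2 + 1" by simp
    qed auto
    then show "avg \<Omega> (\<lambda>\<omega>. ((\<Sum>u\<in>U. of_bool (\<omega> u = i)) - real n / real k)\<^sup>2) \<le> t\<^sup>2"
      using U by (simp only: mean t)
  qed
  have dev_V: "avg \<Omega> (\<lambda>\<omega>. \<bar>(\<Sum>v\<in>V. X i v \<omega>) - (\<Sum>v\<in>V. avg \<Omega> (X i v))\<bar>) \<le> t" for i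
  proof (rule avg_abs_le[OF fin ne t(1)])
    have "avg \<Omega> (\<lambda>\<omega>. ((\<Sum>v\<in>V. X i v \<omega>) - (\<Sum>v\<in>V. avg \<Omega> (X i v)))\<^sup>2)
        \<le> real (card V) * real (\<Delta>\<^sup>2 + 1)"
    proof (rule avg_square_deviation_le[OF \<Omega> fin ne V(1)])
      fix v assume v: "v \<in> V"
      have "g \<omega> v = g \<omega>' v" if "\<forall>x\<in>A v. \<omega> x = \<omega>' x" for \<omega> \<omega>'
      proof -
        have "\<omega> ` N v = \<omega>' ` N v" using that by (intro image_cong) (auto simp: A_def)
        then show ?thesis using that by (simp add: g_def A_def)
      qed
      then show "depends_on \<Omega> (X i v) (A v)"
        unfolding depends_on_def X_def by metis
      have finN: "finite (N v)" using N(1)[OF v] U finite_subset by blast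
      \<comment> \<open>Since \<open>N v\<close> and \<open>N w\<close> lie in \<open>U\<close>, an
        overlap means \<open>w = v\<close> or a common neighbor.\<close>
      have "{w \<in> V. A v \<inter> A w \<noteq> {}} \<subseteq> insert v (\<Union>u\<in>N v. {w \<in> V. u \<in> N w})"
        using v N(1) UV by (auto simp: A_def)
      then have "card {w \<in> V. A v \<inter> A w \<noteq> {}} \<le> card (insert v (\<Union>u\<in>N v. {w \<in> V. u \<in> N w}))"
        using finN V by (intro card_mono) auto
      also have "\<dots> \<le> Suc (card (\<Union>u\<in>N v. {w \<in> V. u \<in> N w}))" by (rule card_insert_le_m1) auto
      also have "card (\<Union>u\<in>N v. {w \<in> V. u \<in> N w}) \<le> (\<Sum>u\<in>N v. card {w \<in> V. u \<in> N w})"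
        by (rule card_UN_le[OF finN])
      also have "\<dots> \<le> (\<Sum>u\<in>N v. \<Delta>)" using deg N(1)[OF v] by (intro sum_mono) auto
      also have "\<dots> \<le> \<Delta>\<^sup>2" using N(2)[OF v] by (simp add: power2_eq_square)
      finally show "card {w \<in> V. A v \<inter> A w \<noteq> {}} \<le> \<Delta>\<^sup>2 + 1" by simp
    qed (auto simp: X_def)
    then show "avg \<Omega> (\<lambda>\<omega>. ((\<Sum>v\<in>V. X i v \<omega>) - (\<Sum>v\<in>V. avg \<Omega> (X i v)))\<^sup>2) \<le> t\<^sup>2"
      using V by (simp only: t)
  qed

  define F where "F \<omega> = (\<Sum>i<k. \<bar>(\<Sum>u\<in>U. of_bool (\<omega> u = i)) - (\<Sum>v\<in>V. X i v \<omega>)\<bar>)" for \<omega>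
  \<comment> \<open>The expected number of uncolored vertices per color. A class on \<open>V\<close>
    has mean size \<open>n / k - \<beta>\<close>, while a class on \<open>U\<close> has mean size
    \<open>n / k\<close>; the next estimate is the triangle inequality through these two
    means.\<close>
  define \<beta> where "\<beta> = (\<Sum>v\<in>V. b v) / real k"
  have "avg \<Omega> F \<le> avg \<Omega> (\<lambda>\<omega>. \<Sum>i<k. \<bar>(\<Sum>u\<in>U. of_bool (\<omega> u = i)) - real n / real k\<bar>
      + \<bar>(\<Sum>v\<in>V. X i v \<omega>) - (\<Sum>v\<in>V. avg \<Omega> (X i v))\<bar> + \<beta>)"
  proof (rule avg_mono)
    fix \<omega> assume "\<omega> \<in> \<Omega>"
    have b0: "0 \<le> \<beta>"
      unfolding \<beta>_def b_def avg_def X_def by (intro divide_nonneg_nonneg sum_nonneg) auto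
    show "F \<omega> \<le> (\<Sum>i<k. \<bar>(\<Sum>u\<in>U. of_bool (\<omega> u = i)) - real n / real k\<bar>
      + \<bar>(\<Sum>v\<in>V. X i v \<omega>) - (\<Sum>v\<in>V. avg \<Omega> (X i v))\<bar> + \<beta>)"
      unfolding F_def
    proof (intro sum_mono)
      fix i assume "i \<in> {..<k}"
      then have "(\<Sum>v\<in>V. avg \<Omega> (X i v)) = real n / real k - \<beta>"
        using V by (simp add: avg_X \<beta>_def sum_subtractf sum_divide_distrib[symmetric] diff_divide_distrib)
      then show "\<bar>(\<Sum>u\<in>U. of_bool (\<omega> u = i)) - (\<Sum>v\<in>V. X i v \<omega>)\<bar>
         \<le> \<bar>(\<Sum>u\<in>U. of_bool (\<omega> u = i)) - real n / real k\<bar>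
      + \<bar>(\<Sum>v\<in>V. X i v \<omega>) - (\<Sum>v\<in>V. avg \<Omega> (X i v))\<bar> + \<beta>"
        using b0 by linarith
    qed
  qed
  also have "\<dots> = (\<Sum>i<k. avg \<Omega> (\<lambda>\<omega>. \<bar>(\<Sum>u\<in>U. of_bool (\<omega> u = i)) - real n / real k\<bar>)
      + avg \<Omega> (\<lambda>\<omega>. \<bar>(\<Sum>v\<in>V. X i v \<omega>) - (\<Sum>v\<in>V. avg \<Omega> (X i v))\<bar>) + \<beta>)"
    unfolding avg_sum avg_add avg_const[OF fin ne] ..
  also have "\<dots> \<le> (\<Sum>i<k. t + t + \<beta>)"
    using dev_U dev_V by (intro sum_mono add_mono) auto
  also have "\<dots> = 2 * real k * t + (\<Sum>v\<in>V. b v)"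
    using k by (simp add: \<beta>_def algebra_simps)
  also have "\<dots> \<le> 2 * real k * t + real n * p"
    using sum_mono[of V b "\<lambda>_. p"] b_le V by simp
  finally obtain \<omega> where \<omega>: "\<omega> \<in> \<Omega>" "F \<omega> \<le> 2 * real k * t + real n * p"
    using exists_le_avg[OF fin ne, of F] by force
  have "F \<omega> = (\<Sum>i<k. \<bar>real (card {u \<in> U. \<omega> u = i}) - real (card {v \<in> V. g \<omega> v = i})\<bar>)"
    unfolding F_def X_def using U V by (simp add: of_bool_def sum.If_cases Int_def)
  moreover have "g \<omega> v \<notin> \<omega> ` N v" if "v \<in> V" "g \<omega> v < k" for v
    using pick_color_avoids(2)[OF rng[OF \<omega>(1) NI(2)[OF that(1)]], of "\<omega> ` N v"]
      g_eq_k[OF \<omega>(1) that(1)] that(2) unfolding g_def by (metis less_irrefl)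
  moreover have "\<omega> u < k" if "u \<in> U" for u using rng[OF \<omega>(1)] that by (simp add: I_def)
  ultimately show ?thesis
    using \<omega>(2) unfolding t_def p_def by (intro exI[of _ \<omega>] exI[of _ "g \<omega>"] conjI ballI impI) simp_all
qed

section \<open>Completing a partial coloring with two extra colors\<close>

text \<open>Trimming each class to the smaller of its two sides leaves sets \<open>U'\<close> and
  \<open>V'\<close> of equal size \<open>l\<close>. Color \<open>k\<close> joins \<open>V'\<close>
  to a set \<open>P\<close> taken from one large class \<open>A j\<close>, and color
  \<open>k + 1\<close> joins \<open>U'\<close> to a set \<open>Q\<close> taken from
  \<open>B j\<close>. Both \<open>P\<close> and \<open>Q\<close> have \<open>l\<close> elements, so
  class \<open>j\<close> stays balanced.\<close>

lemma exists_balanced_coloring_from_partial: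
  fixes U V :: "'a set" and k \<Delta> n :: nat and L :: real
  assumes G: "bipartite_graph U V E" and U: "card U = n" and V: "card V = n" and k: "k > 0"
    and degU: "\<And>u. u \<in> U \<Longrightarrow> card {v \<in> V. {u, v} \<in> E} \<le> \<Delta>"
    and degV: "\<And>v. v \<in> V \<Longrightarrow> card {u \<in> U. {u, v} \<in> E} \<le> \<Delta>"
    and f: "\<And>u. u \<in> U \<Longrightarrow> f u < k"
    and fg: "\<And>u v. u \<in> U \<Longrightarrow> v \<in> V \<Longrightarrow> {u, v} \<in> E \<Longrightarrow> g v < k \<Longrightarrow> f u \<noteq> g v"
    and mismatch: "(\<Sum>i<k. \<bar>real (card {u \<in> U. f u = i}) - real (card {v \<in> V. g v = i})\<bar>) \<le> L"
    and room: "real k * (1 + real \<Delta>) * L \<le> real n - L"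
  shows "\<exists>c. balanced_coloring U V E c \<and> c ` (U \<union> V) \<subseteq> {..<k + 2}"
proof -
  have fin: "finite U" "finite V" and UV: "U \<inter> V = {}"
    using G by (auto simp: bipartite_graph_def)
  define m where "m i = min (card {u \<in> U. f u = i}) (card {v \<in> V. g v = i})" for i
  have "\<forall>i. \<exists>A. A \<subseteq> {u \<in> U. f u = i} \<and> card A = m i"
    unfolding m_def by (meson obtain_subset_with_card_n min.cobounded1)
  from choice[OF this] obtain A where "\<forall>i. A i \<subseteq> {u \<in> U. f u = i} \<and> card (A i) = m i" ..
  then have A: "A i \<subseteq> {u \<in> U. f u = i}" "card (A i) = m i" for i
    by (simp_all only: simp_thms)
  have "\<forall>i. \<exists>B. B \<subseteq> {v \<in> V. g v = i} \<and> card B = m i"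
    unfolding m_def by (meson obtain_subset_with_card_n min.cobounded2)
  from choice[OF this] obtain B where "\<forall>i. B i \<subseteq> {v \<in> V. g v = i} \<and> card (B i) = m i" ..
  then have B: "B i \<subseteq> {v \<in> V. g v = i}" "card (B i) = m i" for i
    by (simp_all only: simp_thms)
  define U' where "U' = U - (\<Union>i<k. A i)"
  define V' where "V' = V - (\<Union>i<k. B i)"
  define l where "l = card U'"
  have memA: "x \<in> U \<and> f x = i" if "x \<in> A i" for x i using A(1)[of i] that by blast
  have memB: "x \<in> V \<and> g x = i" if "x \<in> B i" for x i using B(1)[of i] that by blast
  have finA: "finite (A i)" and finB: "finite (B i)" for i
    using fin A(1)[of i] B(1)[of i] by (auto intro: finite_subset)
  have cA: "card (\<Union>i<k. A i) = (\<Sum>i<k. m i)"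
  proof -
    have "A i \<inter> A j = {}" if "i \<noteq> j" for i j using memA that by blast
    then have "card (\<Union>i<k. A i) = (\<Sum>i<k. card (A i))"
      using finA by (intro card_UN_disjoint) auto
    then show ?thesis by (simp add: A(2))
  qed
  have cB: "card (\<Union>i<k. B i) = (\<Sum>i<k. m i)"
  proof -
    have "B i \<inter> B j = {}" if "i \<noteq> j" for i j using memB that by blast
    then have "card (\<Union>i<k. B i) = (\<Sum>i<k. card (B i))"
      using finB by (intro card_UN_disjoint) auto
    then show ?thesis by (simp add: B(2))
  qed
  have subA: "(\<Union>i<k. A i) \<subseteq> U" and subB: "(\<Union>i<k. B i) \<subseteq> V"
    using memA memB by blast+
  have "(\<Sum>i<k. m i) \<le> n" using card_mono[OF fin(1) subA] cA U by simp
  have lU: "l = n - (\<Sum>i<k. m i)"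
    unfolding l_def U'_def using subA fin cA U by (subst card_Diff_subset) (auto intro: finite_subset)
  have lV: "card V' = l"
    unfolding lU V'_def using subB fin cB V by (subst card_Diff_subset) (auto intro: finite_subset)
  have l: "real l = real n - (\<Sum>i<k. real (m i))"
    using lU \<open>(\<Sum>i<k. m i) \<le> n\<close> by (simp add: of_nat_diff)
  have "(\<Union>i<k. {u \<in> U. f u = i}) = U" using f by auto
  \<comment> \<open>Since \<open>f\<close> colors all of \<open>U\<close>, the leftover
    \<open>l\<close> is the total excess of the classes on \<open>U\<close> over their trimmed
    sizes, which the mismatch dominates.\<close>
  then have "n = (\<Sum>i<k. card {u \<in> U. f u = i})"
    using fin U by (subst card_UN_disjoint[symmetric]) auto
  then have "real l = (\<Sum>i<k. real (card {u \<in> U. f u = i}) - real (m i))"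
    by (simp add: l sum_subtractf)
  also have "\<dots> \<le> (\<Sum>i<k. \<bar>real (card {u \<in> U. f u = i}) - real (card {v \<in> V. g v = i})\<bar>)"
    by (intro sum_mono) (auto simp: m_def min_def)
  finally have lL: "real l \<le> L" using mismatch by linarith

  \<comment> \<open>Pigeonhole: the trimmed sizes add up to \<open>n - l\<close>, which
    \<open>room\<close> keeps at or above \<open>k * (1 + \<Delta>) * l\<close>. Of the vertices on
    one side of class \<open>j\<close>, \<open>\<Delta> * l\<close> are reserved for neighbors of
    the leftover set and \<open>l\<close> for the set to be chosen.\<close>
  have "\<exists>j<k. (1 + \<Delta>) * l \<le> m j"
  proof (rule ccontr)
    assume "\<not> ?thesis"
    then have "(\<Sum>i<k. real (m i)) < (\<Sum>i<k. (1 + real \<Delta>) * real l)"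
      using k by (intro sum_strict_mono) (auto simp: not_le simp flip: of_nat_mult of_nat_add of_nat_Suc)
    also have "\<dots> = real k * (1 + real \<Delta>) * real l" by simp
    also have "\<dots> \<le> real k * (1 + real \<Delta>) * L" using lL by (intro mult_left_mono) auto
    finally show False using room l lL by linarith
  qed
  then obtain j where j: "j < k" "(1 + \<Delta>) * l \<le> m j" by blast
  have U'V': "U' \<subseteq> U" "V' \<subseteq> V" "finite U'" "finite V'" using fin by (auto simp: U'_def V'_def)

  have "\<exists>P \<subseteq> A j - (\<Union>v\<in>V'. {u \<in> U. {u, v} \<in> E}). card P = l"
  proof -
    have "card (\<Union>v\<in>V'. {u \<in> U. {u, v} \<in> E}) \<le> (\<Sum>v\<in>V'. card {u \<in> U. {u, v} \<in> E})"
      by (rule card_UN_le[OF U'V'(4)])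
    also have "\<dots> \<le> (\<Sum>v\<in>V'. \<Delta>)" using U'V' degV by (intro sum_mono) auto
    also have "\<dots> = \<Delta> * l" using lV by simp
    finally have "card (A j) - card (\<Union>v\<in>V'. {u \<in> U. {u, v} \<in> E}) \<ge> l" using j A(2)[of j] by simp
    then have "l \<le> card (A j - (\<Union>v\<in>V'. {u \<in> U. {u, v} \<in> E}))"
      using diff_card_le_card_Diff[of "\<Union>v\<in>V'. {u \<in> U. {u, v} \<in> E}" "A j"] U'V' fin by simp
    then show ?thesis by (rule obtain_subset_with_card_n) blast
  qed
  then obtain P where P: "P \<subseteq> A j - (\<Union>v\<in>V'. {u \<in> U. {u, v} \<in> E})" "card P = l" by blast
  have "\<exists>Q \<subseteq> B j - (\<Union>u\<in>U'. {v \<in> V. {u, v} \<in> E}). card Q = l"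
  proof -
    have "card (\<Union>u\<in>U'. {v \<in> V. {u, v} \<in> E}) \<le> (\<Sum>u\<in>U'. card {v \<in> V. {u, v} \<in> E})"
      by (rule card_UN_le[OF U'V'(3)])
    also have "\<dots> \<le> (\<Sum>u\<in>U'. \<Delta>)" using U'V' degU by (intro sum_mono) auto
    also have "\<dots> = \<Delta> * l" by (simp add: l_def)
    finally have "card (B j) - card (\<Union>u\<in>U'. {v \<in> V. {u, v} \<in> E}) \<ge> l" using j B(2)[of j] by simp
    then have "l \<le> card (B j - (\<Union>u\<in>U'. {v \<in> V. {u, v} \<in> E}))"
      using diff_card_le_card_Diff[of "\<Union>u\<in>U'. {v \<in> V. {u, v} \<in> E}" "B j"] U'V' fin by simp
    then show ?thesis by (rule obtain_subset_with_card_n) blast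
  qed
  then obtain Q where Q: "Q \<subseteq> B j - (\<Union>u\<in>U'. {v \<in> V. {u, v} \<in> E})" "card Q = l" by blast
  have PQ: "P \<subseteq> A j" "Q \<subseteq> B j" using P Q by auto
  have PU: "P \<subseteq> U" "P \<inter> U' = {}" and QV: "Q \<subseteq> V" "Q \<inter> V' = {}"
    using PQ memA memB j unfolding U'_def V'_def by blast+

  have PE: "{x, y} \<notin> E" if "x \<in> P" "y \<in> V'" for x y using P(1) PU that by blast
  have QE: "{x, y} \<notin> E" if "x \<in> U'" "y \<in> Q" for x y using Q(1) QV that by blast

  \<comment> \<open>A vertex of \<open>V\<close> with \<open>g x \<ge> k\<close> lies in no
    \<open>B i\<close> with \<open>i < k\<close>, hence in \<open>V'\<close>, so it receives color
    \<open>k\<close> and its value under \<open>g\<close> never becomes a color.\<close>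
  define c where "c x = (if x \<in> P \<union> V' then k else if x \<in> Q \<union> U' then k + 1
      else if x \<in> U then f x else g x)" for x
  have inA: "x \<in> U \<and> x \<notin> U' \<longleftrightarrow> x \<in> A (f x) \<and> f x < k" for x
    unfolding U'_def using memA f by blast
  have inB: "x \<in> V \<and> x \<notin> V' \<longleftrightarrow> x \<in> B (g x) \<and> g x < k" for x
    unfolding V'_def using memB by blast
  have cU: "c x = (if x \<in> P then k else if x \<in> U' then k + 1 else f x)" if "x \<in> U" for x
    using that UV U'V' QV unfolding c_def by auto
  have cV: "c x = (if x \<in> V' then k else if x \<in> Q then k + 1 else g x)" if "x \<in> V" for x
    using that UV U'V' PU unfolding c_def by auto
  have classU: "color_class U V c i \<inter> U =
      (if i < k then A i - P else if i = k then P else if i = k + 1 then U' else {})" for i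
  proof -
    have *: "x \<in> U \<and> c x = i \<longleftrightarrow>
      x \<in> (if i < k then A i - P else if i = k then P else if i = k + 1 then U' else {})" for x
    proof (cases "x \<in> U")
      case True
      then show ?thesis
        using cU[of x] PU inA[of x] A(1)[of i] f[of x] by (auto split: if_splits)
    next
      case False
      then show ?thesis using PU U'V' A(1)[of i] by auto
    qed
    have "color_class U V c i \<inter> U = {x. x \<in> U \<and> c x = i}" by (auto simp: color_class_def)
    then show ?thesis unfolding * Collect_mem_eq .
  qed
  have classV: "color_class U V c i \<inter> V =
      (if i < k then B i - Q else if i = k then V' else if i = k + 1 then Q else {})" for i
  proof -
    have *: "x \<in> V \<and> c x = i \<longleftrightarrow>
      x \<in> (if i < k then B i - Q else if i = k then V' else if i = k + 1 then Q else {})" for x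
    proof (cases "x \<in> V")
      case True
      then show ?thesis
        using cV[of x] QV inB[of x] B(1)[of i] by (auto split: if_splits)
    next
      case False
      then show ?thesis using QV U'V' B(1)[of i] by auto
    qed
    have "color_class U V c i \<inter> V = {x. x \<in> V \<and> c x = i}" by (auto simp: color_class_def)
    then show ?thesis unfolding * Collect_mem_eq .
  qed
  have "bi_hole U V E (color_class U V c i \<inter> U) (color_class U V c i \<inter> V)" for i
  proof -
    consider "i < k" | "i = k" | "i = k + 1" | "i > k + 1" by linarith
    then show ?thesis
    proof cases
      case 1
      \<comment> \<open>Only class \<open>j\<close> gives up vertices, and it gives up
        \<open>l\<close> on each side.\<close>
      have "card (A i - P) = card (B i - Q)"
      proof (cases "i = j")
        case True
        then show ?thesis using PQ P(2) Q(2) A(2) B(2) finA finB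
          by (simp add: card_Diff_subset finite_subset)
      next
        case False
        then have "A i \<inter> P = {}" "B i \<inter> Q = {}" using PQ memA memB by blast+
        then show ?thesis using A(2) B(2) by (simp add: Diff_triv)
      qed
      moreover have "{x, y} \<notin> E" if "x \<in> A i - P" "y \<in> B i - Q" for x y
        using fg[of x y] A(1)[of i] B(1)[of i] that 1 by auto
      ultimately show ?thesis
        using 1 A(1)[of i] B(1)[of i] unfolding classU classV bi_hole_def by auto
    next
      case 2
      then show ?thesis using P(2) PE lV PU U'V' unfolding classU classV bi_hole_def by auto
    next
      case 3
      then show ?thesis using Q(2) QE QV U'V' unfolding classU classV bi_hole_def l_def by auto
    next
      case 4
      then show ?thesis unfolding classU classV bi_hole_def by auto
    qed
  qed
  moreover have "c ` (U \<union> V) \<subseteq> {..<k + 2}"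
  proof -
    have "c x < k + 2" if "x \<in> U" for x using cU[OF that] f[OF that] by auto
    moreover have "c x < k + 2" if "x \<in> V" for x using cV[OF that] inB[of x] that by auto
    ultimately show ?thesis by auto
  qed
  ultimately show ?thesis unfolding balanced_coloring_def by blast
qed

section \<open>Asymptotics for the number of colors\<close>

text \<open>\<open>r x\<close> is the number of colors before rounding. The gap between
  \<open>\<epsilon> / 2\<close> and \<open>\<epsilon>\<close> absorbs the two extra colors. In the
  last bound the exponential is at least \<open>x powr (- a)\<close> with \<open>a < 1\<close>, so
  the right side grows faster than any multiple of the logarithm.\<close>

lemma eventually_color_number_bounds:
  fixes \<epsilon> :: real
  assumes "\<epsilon> > 0"
  defines "r \<equiv> \<lambda>x. (1 + \<epsilon> / 2) * (x / ln x)"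
  shows "\<forall>\<^sub>F x :: real in at_top. 4 \<le> r x \<and> r x \<le> x \<and> r x + 2 \<le> (1 + \<epsilon>) * (x / ln x)
    \<and> ln (8 * x\<^sup>2) \<le> (r x - 1) * exp (- (x / (r x - 2)))"
proof -
  \<comment> \<open>Using \<open>\<epsilon> / 4\<close> in place of \<open>\<epsilon> / 2\<close>
    absorbs the subtracted 2 in \<open>r x - 2\<close>.\<close>
  define a where "a = 1 / (1 + \<epsilon> / 4)"
  have a: "0 < a" "a < 1" using assms(1) by (auto simp: a_def field_simps)
  have r4: "\<forall>\<^sub>F x :: real in at_top. 4 \<le> r x" unfolding r_def using assms(1) by real_asymp
  moreover have "\<forall>\<^sub>F x :: real in at_top. r x \<le> x" unfolding r_def using assms(1) by real_asymp
  moreover have "\<forall>\<^sub>F x :: real in at_top. r x + 2 \<le> (1 + \<epsilon>) * (x / ln x)"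
    unfolding r_def using assms(1) by real_asymp
  moreover have "\<forall>\<^sub>F x :: real in at_top. ln (8 * x\<^sup>2) \<le> (r x - 1) * exp (- (x / (r x - 2)))"
  proof -
    have "\<forall>\<^sub>F x :: real in at_top. (1 + \<epsilon> / 4) * (x / ln x) \<le> r x - 2"
      unfolding r_def using assms(1) by real_asymp
    moreover have "\<forall>\<^sub>F x :: real in at_top. x / ln x \<le> r x - 1"
      unfolding r_def using assms(1) by real_asymp
    moreover have "\<forall>\<^sub>F x :: real in at_top. ln (8 * x\<^sup>2) \<le> x / ln x * x powr (- a)"
      using a by real_asymp
    moreover have "\<forall>\<^sub>F x :: real in at_top. x > 1" by real_asymp
    ultimately show ?thesis using r4
    proof eventually_elim
      case (elim x)
      have "x / (r x - 2) \<le> x / ((1 + \<epsilon> / 4) * (x / ln x))"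
        using elim assms(1) by (intro divide_left_mono mult_pos_pos) auto
      also have "\<dots> = a * ln x" using elim assms(1) by (simp add: a_def)
      finally have "x powr (- a) \<le> exp (- (x / (r x - 2)))"
        using elim by (simp add: powr_def)
      then have "x / ln x * x powr (- a) \<le> (r x - 1) * exp (- (x / (r x - 2)))"
        using elim by (intro mult_mono) auto
      then show ?case using elim by linarith
    qed
  qed
  ultimately show ?thesis by eventually_elim blast
qed

text \<open>Let \<open>y\<close> be the probability that a given color is missing from
  \<open>\<Delta>\<close> labels. The inequality
  \<open>1 - 1 / k \<ge> exp (- (1 / (k - 1)))\<close> together with \<open>k - 1 > r - 2\<close>
  gives \<open>y \<ge> exp (- (\<Delta> / (r - 2)))\<close>, and
  \<open>(1 - y) ^ k \<le> exp (- (k * y))\<close> finishes the estimate.\<close>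

lemma coupon_collector_tail:
  fixes k \<Delta> :: nat and r :: real
  assumes r: "4 \<le> r" and k: "r - 1 < real k"
    and \<Delta>: "\<Delta> > 0" "ln (8 * (real \<Delta>)\<^sup>2) \<le> (r - 1) * exp (- (real \<Delta> / (r - 2)))"
  shows "(1 - (1 - 1 / real k) ^ \<Delta>) ^ k \<le> 1 / (8 * (real \<Delta>)\<^sup>2)"
proof -
  define y where "y = (1 - 1 / real k) ^ \<Delta>"
  have k3: "real k > 3" using r k by linarith
  have "exp (- (1 / (r - 2))) \<le> 1 - 1 / real k"
  proof -
    have "exp (- (1 / (r - 2))) \<le> exp (- (1 / (real k - 1)))"
      using r k by (simp add: frac_le)
    also have "\<dots> = 1 / exp (1 / (real k - 1))" by (simp add: exp_minus divide_inverse)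
    also have "\<dots> \<le> 1 / (1 + 1 / (real k - 1))"
      using k3 exp_ge_add_one_self[of "1 / (real k - 1)"] by (intro divide_left_mono mult_pos_pos add_pos_pos) auto
    also have "\<dots> = 1 - 1 / real k" using k3 by (simp add: field_simps)
    finally show ?thesis .
  qed
  then have "exp (- (1 / (r - 2))) ^ \<Delta> \<le> y" unfolding y_def by (intro power_mono) auto
  then have y: "exp (- (real \<Delta> / (r - 2))) \<le> y" by (simp flip: exp_of_nat_mult)
  have "0 \<le> 1 - 1 / real k" "1 - 1 / real k \<le> 1" using k3 by auto
  then have "y \<le> 1" unfolding y_def by (intro power_le_one)
  have "(1 - y) ^ k \<le> exp (- y) ^ k"
    using exp_ge_add_one_self[of "- y"] \<open>y \<le> 1\<close> by (intro power_mono) auto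
  also have "\<dots> = exp (- (real k * y))" by (simp flip: exp_of_nat_mult)
  also have "\<dots> \<le> exp (- ln (8 * (real \<Delta>)\<^sup>2))"
  proof -
    have "(r - 1) * exp (- (real \<Delta> / (r - 2))) \<le> real k * y"
      using r k y by (intro mult_mono) auto
    then show ?thesis using \<Delta> by simp
  qed
  also have "\<dots> = 1 / (8 * (real \<Delta>)\<^sup>2)"
  proof -
    have "0 < 8 * (real \<Delta>)\<^sup>2" using \<Delta> by simp
    then show ?thesis by (simp only: exp_minus exp_ln inverse_eq_divide)
  qed
  finally show ?thesis by (simp add: y_def)
qed

section \<open>Assembling the bound on the coloring number\<close>

text \<open>Degrees count incident edges, whereas the coloring lemmas count neighbors;
  \<open>y \<mapsto> {x, y}\<close> injects the neighbors of \<open>x\<close> into its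
  edges.\<close>

lemma card_neighbors_le_max_degree:
  assumes G: "bipartite_graph U V E" and x: "x \<in> U \<union> V"
  shows "card {y. {x, y} \<in> E} \<le> max_degree U V E"
proof -
  have fin: "finite U" "finite V" and edge: "\<And>e. e \<in> E \<Longrightarrow> \<exists>u\<in>U. \<exists>v\<in>V. e = {u, v}"
    using G by (auto simp: bipartite_graph_def)
  have "E \<subseteq> Pow (U \<union> V)" using edge by blast
  then have finE: "finite E" using fin by (meson finite_Pow_iff finite_UnI finite_subset)
  have "inj_on (\<lambda>y. {x, y}) {y. {x, y} \<in> E}" by (auto simp: inj_on_def doubleton_eq_iff)
  then have "card {y. {x, y} \<in> E} = card ((\<lambda>y. {x, y}) ` {y. {x, y} \<in> E})"
    by (simp add: card_image)
  also have "\<dots> \<le> degree E x"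
    unfolding degree_def using finE by (intro card_mono) auto
  also have "\<dots> \<le> max_degree U V E"
    unfolding max_degree_def using fin x by (intro Max_ge) auto
  finally show ?thesis .
qed

lemma finite_neighbors:
  assumes G: "bipartite_graph U V E"
  shows "finite {y. {x, y} \<in> E}"
proof (rule finite_subset)
  show "{y. {x, y} \<in> E} \<subseteq> U \<union> V"
  proof
    fix y assume "y \<in> {y. {x, y} \<in> E}"
    then obtain u v where "u \<in> U" "v \<in> V" "{x, y} = {u, v}"
      using G unfolding bipartite_graph_def mem_Collect_eq by meson
    then show "y \<in> U \<union> V" by (auto simp: doubleton_eq_iff)
  qed
  show "finite (U \<union> V)" using G by (simp add: bipartite_graph_def)
qed

lemma chi_B_le:
  assumes "balanced_coloring U V E c" "c ` (U \<union> V) \<subseteq> {..<m}"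
  shows "chi_B U V E \<le> enat m"
proof -
  have "chi_B U V E \<le> enat (card (c ` (U \<union> V)))"
    unfolding chi_B_def using assms(1) by (intro INF_lower) simp
  also have "\<dots> \<le> enat m" using card_mono[OF _ assms(2)] by simp
  finally show ?thesis .
qed

text \<open>Fluctuations and uncolored vertices each contribute at most
  \<open>n / (8 * \<Delta>\<^sup>2)\<close> to the mismatch, the former by the size of
  \<open>n\<close>, the latter by \<open>tail\<close>. The resulting
  \<open>L = n / (4 * \<Delta>\<^sup>2)\<close> is small enough for the completion step because
  \<open>k \<le> \<Delta>\<close>.\<close>

lemma chi_B_le_of_large_order:
  fixes k \<Delta> n :: nat
  assumes G: "bipartite_graph U V E" and UV: "card U = n" "card V = n"
    and deg: "max_degree U V E = \<Delta>" and k: "0 < k" "k \<le> \<Delta>"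
    and tail: "(1 - (1 - 1 / real k) ^ \<Delta>) ^ k \<le> 1 / (8 * (real \<Delta>)\<^sup>2)"
    and n: "(16 * k * \<Delta>\<^sup>2)\<^sup>2 * (\<Delta>\<^sup>2 + 1) \<le> n"
  shows "chi_B U V E \<le> enat (k + 2)"
proof -
  define N where "N v = {u \<in> U. {u, v} \<in> E}" for v
  have fin: "finite U" "finite V" "U \<inter> V = {}" using G by (auto simp: bipartite_graph_def)
  have \<Delta>0: "\<Delta> > 0" using k by linarith
  have "0 < (16 * k * \<Delta>\<^sup>2)\<^sup>2 * (\<Delta>\<^sup>2 + 1)" using k \<Delta>0 by simp
  then have n0: "n > 0" using n by linarith
  have degU: "card {v \<in> V. {u, v} \<in> E} \<le> \<Delta>" if "u \<in> U" for u
  proof -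
    have "card {v \<in> V. {u, v} \<in> E} \<le> card {v. {u, v} \<in> E}"
      using finite_neighbors[OF G] by (intro card_mono) auto
    then show ?thesis using card_neighbors_le_max_degree[OF G, of u] that deg by simp
  qed
  have degV: "card (N v) \<le> \<Delta>" if "v \<in> V" for v
  proof -
    have "N v \<subseteq> {u. {v, u} \<in> E}" by (auto simp: N_def insert_commute)
    from card_mono[OF finite_neighbors[OF G] this] show ?thesis using card_neighbors_le_max_degree[OF G, of v] that deg by simp
  qed
  have "\<exists>f g. (\<forall>u\<in>U. f u < k) \<and> (\<forall>v\<in>V. g v < k \<longrightarrow> g v \<notin> f ` N v) \<and>
    (\<Sum>i<k. \<bar>real (card {u \<in> U. f u = i}) - real (card {v \<in> V. g v = i})\<bar>)
      \<le> 2 * real k * sqrt (real n * (real \<Delta> ^ 2 + 1)) + real n * (1 - (1 - 1 / real k) ^ \<Delta>) ^ k"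
  proof (rule exists_nearly_balanced_partial_coloring)
    fix u assume "u \<in> U"
    then have "{v \<in> V. u \<in> N v} = {v \<in> V. {u, v} \<in> E}" by (auto simp: N_def)
    then show "card {v \<in> V. u \<in> N v} \<le> \<Delta>" using degU[OF \<open>u \<in> U\<close>] by simp
  qed (use fin UV n0 k degV in \<open>auto simp: N_def\<close>)
  then obtain f g where f: "\<And>u. u \<in> U \<Longrightarrow> f u < k"
    and g: "\<And>v. v \<in> V \<Longrightarrow> g v < k \<Longrightarrow> g v \<notin> f ` N v"
    and mis: "(\<Sum>i<k. \<bar>real (card {u \<in> U. f u = i}) - real (card {v \<in> V. g v = i})\<bar>)
      \<le> 2 * real k * sqrt (real n * (real \<Delta> ^ 2 + 1)) + real n * (1 - (1 - 1 / real k) ^ \<Delta>) ^ k"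
    by blast
  define L where "L = real n / (4 * (real \<Delta>)\<^sup>2)"
  \<comment> \<open>After squaring, this is the lower bound on \<open>n\<close>. The factor
    \<open>16 * k\<close> turns the coefficient \<open>2 * k\<close> of the root into the target
    \<open>1 / 8\<close>.\<close>
  have "sqrt (real n * (real \<Delta> ^ 2 + 1)) \<le> real n / (16 * real k * (real \<Delta>)\<^sup>2)"
  proof (rule real_le_lsqrt)
    have "real ((16 * k * \<Delta>\<^sup>2)\<^sup>2 * (\<Delta>\<^sup>2 + 1)) \<le> real n" using n by (simp only: of_nat_le_iff)
    then have "(16 * real k * (real \<Delta>)\<^sup>2)\<^sup>2 * ((real \<Delta>)\<^sup>2 + 1) \<le> real n"
      by (simp only: of_nat_mult of_nat_power of_nat_add of_nat_numeral of_nat_1)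
    then have "real n * ((16 * real k * (real \<Delta>)\<^sup>2)\<^sup>2 * ((real \<Delta>)\<^sup>2 + 1)) \<le> real n * real n"
      by (intro mult_left_mono) auto
    moreover have "0 < (16 * real k * (real \<Delta>)\<^sup>2)\<^sup>2" using k \<Delta>0 by simp
    ultimately show "real n * (real \<Delta> ^ 2 + 1) \<le> (real n / (16 * real k * (real \<Delta>)\<^sup>2))\<^sup>2"
      by (simp only: power_divide pos_le_divide_eq power2_eq_square[of "real n"] mult_ac)
  qed (auto intro!: mult_nonneg_nonneg add_nonneg_nonneg)
  then have "2 * real k * sqrt (real n * (real \<Delta> ^ 2 + 1)) \<le> 2 * real k * (real n / (16 * real k * (real \<Delta>)\<^sup>2))"
    by (intro mult_left_mono) auto
  also have "\<dots> = real n / (8 * (real \<Delta>)\<^sup>2)" using k by simp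
  finally have sq: "2 * real k * sqrt (real n * (real \<Delta> ^ 2 + 1)) \<le> real n / (8 * (real \<Delta>)\<^sup>2)" .
  have "real n * (1 - (1 - 1 / real k) ^ \<Delta>) ^ k \<le> real n * (1 / (8 * (real \<Delta>)\<^sup>2))"
    using tail by (intro mult_left_mono) auto
  then have L: "(\<Sum>i<k. \<bar>real (card {u \<in> U. f u = i}) - real (card {v \<in> V. g v = i})\<bar>) \<le> L"
    using mis sq by (simp add: L_def)
  have room: "real k * (1 + real \<Delta>) * L \<le> real n - L"
  proof -
    have D1: "1 \<le> real \<Delta>" using \<Delta>0 by simp
    have "real k * (1 + real \<Delta>) + 1 \<le> real \<Delta> * (1 + real \<Delta>) + 1"
      using k by (intro add_right_mono mult_right_mono) auto
    also have "\<dots> \<le> 4 * (real \<Delta>)\<^sup>2"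
    proof -
      have "1 * real \<Delta> \<le> real \<Delta> * real \<Delta>" using D1 by (intro mult_right_mono) auto
      then have "real \<Delta> \<le> (real \<Delta>)\<^sup>2" by (simp only: mult_1_left power2_eq_square)
      moreover have "real \<Delta> * (1 + real \<Delta>) + 1 = real \<Delta> + (real \<Delta>)\<^sup>2 + 1"
        by (simp add: power2_eq_square algebra_simps)
      ultimately show ?thesis using D1 by linarith
    qed
    finally have "(real k * (1 + real \<Delta>) + 1) * L \<le> 4 * (real \<Delta>)\<^sup>2 * L"
      by (intro mult_right_mono) (auto simp: L_def)
    also have "\<dots> = real n" using \<Delta>0 by (simp add: L_def)
    finally show ?thesis by (simp add: algebra_simps)
  qed
  have fg: "f u \<noteq> g v" if "u \<in> U" "v \<in> V" "{u, v} \<in> E" "g v < k" for u v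
    using g[OF that(2) that(4)] that(1,3) unfolding N_def by (metis (mono_tags, lifting) imageI mem_Collect_eq)
  obtain c where "balanced_coloring U V E c" "c ` (U \<union> V) \<subseteq> {..<k + 2}"
    using exists_balanced_coloring_from_partial
      [where f = f and g = g, OF G UV k(1) degU degV[unfolded N_def] f fg L room] by blast
  then show ?thesis by (rule chi_B_le)
qed

theorem theorem1p2:
  fixes \<epsilon> :: real
  assumes "\<epsilon> > 0"
  shows "\<exists>\<Delta>\<^sub>0 :: nat. \<forall>\<Delta> :: nat. \<Delta> \<ge> \<Delta>\<^sub>0 \<longrightarrow>
    (\<exists>N\<^sub>0 :: nat. \<forall>n :: nat. n \<ge> N\<^sub>0 \<longrightarrow>
      (\<forall>(U :: 'a set) (V :: 'a set) (E :: 'a set set).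
         bipartite_graph U V E \<and> card U = n \<and> card V = n \<and> max_degree U V E = \<Delta> \<longrightarrow>
         ereal_of_enat (chi_B U V E) \<le> ereal ((1 + \<epsilon>) * (real \<Delta> / ln (real \<Delta>)))))"
proof -
  define r where "r x = (1 + \<epsilon> / 2) * (x / ln x)" for x :: real
  obtain X where X: "\<And>x. X \<le> x \<Longrightarrow> 4 \<le> r x \<and> r x \<le> x \<and> r x + 2 \<le> (1 + \<epsilon>) * (x / ln x)
      \<and> ln (8 * x\<^sup>2) \<le> (r x - 1) * exp (- (x / (r x - 2)))"
    using eventually_color_number_bounds[OF assms] unfolding r_def eventually_at_top_linorder by blast
  show ?thesis
  proof (rule exI[of _ "nat \<lceil>X\<rceil>"], intro allI impI)
    fix \<Delta> :: nat assume "nat \<lceil>X\<rceil> \<le> \<Delta>"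
    then have "X \<le> real \<Delta>" by linarith
    note X = X[OF this]
    \<comment> \<open>Rounding down keeps \<open>k\<close> below \<open>r\<close> and loses less
      than 1, which accounts for \<open>r - 1\<close> and \<open>r - 2\<close> in the tail
      estimate.\<close>
    define k where "k = nat \<lfloor>r (real \<Delta>)\<rfloor>"
    have k_lower: "r (real \<Delta>) - 1 < real k" and k_upper: "real k \<le> r (real \<Delta>)"
      using X unfolding k_def by linarith+
    have k: "0 < k" "k \<le> \<Delta>" using k_lower k_upper X by linarith+
    have tail: "(1 - (1 - 1 / real k) ^ \<Delta>) ^ k \<le> 1 / (8 * (real \<Delta>)\<^sup>2)"
      using X k k_lower by (intro coupon_collector_tail[of "r (real \<Delta>)"]) auto
    have colors: "real (k + 2) \<le> (1 + \<epsilon>) * (real \<Delta> / ln (real \<Delta>))"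
      using X k_upper by simp
    have "ereal_of_enat (chi_B U V E) \<le> ereal ((1 + \<epsilon>) * (real \<Delta> / ln (real \<Delta>)))"
      if "(16 * k * \<Delta>\<^sup>2)\<^sup>2 * (\<Delta>\<^sup>2 + 1) \<le> n" "bipartite_graph U V E" "card U = n" "card V = n"
        "max_degree U V E = \<Delta>" for n and U V :: "'a set" and E
    proof -
      have "chi_B U V E \<le> enat (k + 2)"
        using that by (intro chi_B_le_of_large_order[OF _ _ _ _ k tail])
      then have "ereal_of_enat (chi_B U V E) \<le> ereal_of_enat (enat (k + 2))"
        by (simp only: ereal_of_enat_le_iff)
      also have "\<dots> \<le> ereal ((1 + \<epsilon>) * (real \<Delta> / ln (real \<Delta>)))"
        using colors by simp
      finally show ?thesis .
    qed
    \<comment> \<open>The witness is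
      \<open>(16 * k * \<Delta>\<^sup>2)\<^sup>2 * (\<Delta>\<^sup>2 + 1)\<close>; for fixed
      \<open>\<epsilon>\<close> it depends only on \<open>\<Delta>\<close>, since \<open>k\<close>
      does.\<close>
    then show "\<exists>N\<^sub>0 :: nat. \<forall>n :: nat. n \<ge> N\<^sub>0 \<longrightarrow>
      (\<forall>(U :: 'a set) (V :: 'a set) (E :: 'a set set).
         bipartite_graph U V E \<and> card U = n \<and> card V = n \<and> max_degree U V E = \<Delta> \<longrightarrow>
         ereal_of_enat (chi_B U V E) \<le> ereal ((1 + \<epsilon>) * (real \<Delta> / ln (real \<Delta>))))"
      by blast
  qed
qed

end
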